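(* Let $\delta$ be a range map. The space $\mathbf{Cl}_\delta$ endowed with the product $\cdot$ is a unital graded magmatic algebra. Moreover, $\cdot$ is associative if and only if $\delta$ is valley-free.
   Context: A range map is a map $\delta : \mathbb{N}\setminus\{0\} \to \mathbb{N}$ (with $0 \in \mathbb{N}$). It is valley-free if there are no $1 \leq i_1 < i_2 < i_3$ such that $\delta(i_1) > \delta(i_2) < \delta(i_3)$. A $\delta$-cliff of size $n$ is a word $u = u_1 \cdots u_n$ of integers with $0 \leq u_i \leq \delta(i)$ for all $1 \leq i \leq n$; $\mathsf{Cl}_\delta(n)$ is the set of $\delta$-cliffs of size $n$ and $\mathsf{Cl}_\delta = \bigsqcup_{n\geq 0} \mathsf{Cl}_\delta(n)$. Let $\mathbb{K}$ be a field of characteristic zero. $\mathbf{Cl}_\delta = \bigoplus_{n \geq 0} \mathbf{Cl}_\delta(n)$ is the graded $\mathbb{K}$-vector space with basis $\{\mathsf{F}_u : u \in \mathsf{Cl}_\delta\}$, $\mathsf{F}_u$ having degree the size of $u$. For $n \geq 0$, $\mathrm{r}_\delta : \mathbb{N}^n \to \mathsf{Cl}_\delta(n)$ is defined by $\mathrm{r}_\delta(u)_i := \min\{u_i, \delta(i)\}$. The bilinear product $\cdot$ on $\mathbf{Cl}_\delta$ is defined, for $u, v \in \mathsf{Cl}_\delta$, by $$\mathsf{F}_u \cdot \mathsf{F}_v = \sum_{\substack{v' \in \mathrm{r}_\delta^{-1}(v)\\ uv' \in \mathsf{Cl}_\delta}} \mathsf{F}_{uv'},$$ where $uv'$ is the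 concatenation. A magmatic algebra is a vector space endowed with a bilinear binary product (not necessarily associative). *)

theory Defs
  imports Complex_Main "HOL-Library.Poly_Mapping"
begin

text \<open>Algebras live on a subspace \<open>A\<close> of an ambient vector space; the product is only
  constrained on \<open>A\<close>.\<close>

locale magmatic_algebra = vector_space scale
  for scale :: "'k::field \<Rightarrow> 'a::ab_group_add \<Rightarrow> 'a" +
  fixes A :: "'a set"
    and mult :: "'a \<Rightarrow> 'a \<Rightarrow> 'a"
  assumes subspace_carrier: "subspace A"
    and mult_closed: "\<lbrakk>x \<in> A; y \<in> A\<rbrakk> \<Longrightarrow> mult x y \<in> A"
    and mult_add_left: "\<lbrakk>x \<in> A; y \<in> A; z \<in> A\<rbrakk> \<Longrightarrow> mult (x + y) z = mult x z + mult y z"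
    and mult_add_right: "\<lbrakk>x \<in> A; y \<in> A; z \<in> A\<rbrakk> \<Longrightarrow> mult x (y + z) = mult x y + mult x z"
    and mult_scale_left: "\<lbrakk>x \<in> A; y \<in> A\<rbrakk> \<Longrightarrow> mult (scale c x) y = scale c (mult x y)"
    and mult_scale_right: "\<lbrakk>x \<in> A; y \<in> A\<rbrakk> \<Longrightarrow> mult x (scale c y) = scale c (mult x y)"

text \<open>The axioms \<open>component_subset\<close> and \<open>decomposition\<close> together say that \<open>A\<close> is the internal
  direct sum of the subspaces \<open>G n\<close>.\<close>

locale graded_magmatic_algebra = magmatic_algebra scale A mult
  for scale :: "'k::field \<Rightarrow> 'a::ab_group_add \<Rightarrow> 'a" and A mult +
  fixes G :: "nat \<Rightarrow> 'a set"
  assumes subspace_component: "subspace (G n)"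
    and component_subset: "G n \<subseteq> A"
    and decomposition: "x \<in> A \<Longrightarrow>
      \<exists>!f. (\<forall>n. f n \<in> G n) \<and> finite {n. f n \<noteq> 0} \<and> x = (\<Sum>n | f n \<noteq> 0. f n)"
    and mult_graded: "\<lbrakk>x \<in> G m; y \<in> G n\<rbrakk> \<Longrightarrow> mult x y \<in> G (m + n)"

locale unital_graded_magmatic_algebra = graded_magmatic_algebra scale A mult G
  for scale :: "'k::field \<Rightarrow> 'a::ab_group_add \<Rightarrow> 'a" and A mult G +
  assumes unital: "\<exists>e \<in> G 0. \<forall>x \<in> A. mult e x = x \<and> mult x e = x"

definition associative_on :: "'a set \<Rightarrow> ('a \<Rightarrow> 'a \<Rightarrow> 'a) \<Rightarrow> bool" where
  "associative_on A mult \<longleftrightarrow>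
    (\<forall>x\<in>A. \<forall>y\<in>A. \<forall>z\<in>A. mult (mult x y) z = mult x (mult y z))"

text \<open>A range map is represented by \<open>\<delta> :: nat \<Rightarrow> nat\<close> whose value at \<open>0\<close> is never used.
  Words are 1-indexed: the letter \<open>u\<^sub>i\<close> is \<open>u ! (i - 1)\<close>.\<close>

definition valley_free :: "(nat \<Rightarrow> nat) \<Rightarrow> bool" where
  "valley_free \<delta> \<longleftrightarrow>
    \<not> (\<exists>i1 i2 i3. 1 \<le> i1 \<and> i1 < i2 \<and> i2 < i3 \<and> \<delta> i1 > \<delta> i2 \<and> \<delta> i2 < \<delta> i3)"

definition cliffs :: "(nat \<Rightarrow> nat) \<Rightarrow> nat list set" where
  "cliffs \<delta> = {u. \<forall>i\<in>{1..length u}. u ! (i - 1) \<le> \<delta> i}"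

definition cliffs_of_size :: "(nat \<Rightarrow> nat) \<Rightarrow> nat \<Rightarrow> nat list set" where
  "cliffs_of_size \<delta> n = {u \<in> cliffs \<delta>. length u = n}"

definition reduction :: "(nat \<Rightarrow> nat) \<Rightarrow> nat list \<Rightarrow> nat list" where
  "reduction \<delta> u = map (\<lambda>i. min (u ! (i - 1)) (\<delta> i)) [1..<Suc (length u)]"

text \<open>The vector space with basis \<open>{F\<^sub>u | u \<in> Cl\<^sub>\<delta>}\<close> is realised as the space of finitely
  supported functions on words whose support consists of cliffs.\<close>

abbreviation pm_scale :: "'k::field \<Rightarrow> ('w \<Rightarrow>\<^sub>0 'k) \<Rightarrow> ('w \<Rightarrow>\<^sub>0 'k)" where
  "pm_scale c \<equiv> Poly_Mapping.map ((*) c)"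

definition F :: "nat list \<Rightarrow> (nat list \<Rightarrow>\<^sub>0 'k::field)" where
  "F u = Poly_Mapping.single u 1"

definition cliff_space :: "(nat \<Rightarrow> nat) \<Rightarrow> (nat list \<Rightarrow>\<^sub>0 'k::field) set" where
  "cliff_space \<delta> = {x. Poly_Mapping.keys x \<subseteq> cliffs \<delta>}"

definition cliff_space_component :: "(nat \<Rightarrow> nat) \<Rightarrow> nat \<Rightarrow> (nat list \<Rightarrow>\<^sub>0 'k::field) set" where
  "cliff_space_component \<delta> n = {x. Poly_Mapping.keys x \<subseteq> cliffs_of_size \<delta> n}"

definition basis_mult :: "(nat \<Rightarrow> nat) \<Rightarrow> nat list \<Rightarrow> nat list \<Rightarrow> (nat list \<Rightarrow>\<^sub>0 'k::field)" where
  "basis_mult \<delta> u v = (\<Sum>v' | reduction \<delta> v' = v \<and> u @ v' \<in> cliffs \<delta>. F (u @ v'))"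

text \<open>Bilinear extension of \<open>basis_mult\<close>.\<close>

definition cliff_mult ::
  "(nat \<Rightarrow> nat) \<Rightarrow> (nat list \<Rightarrow>\<^sub>0 'k::field) \<Rightarrow> (nat list \<Rightarrow>\<^sub>0 'k) \<Rightarrow> (nat list \<Rightarrow>\<^sub>0 'k)" where
  "cliff_mult \<delta> x y = (\<Sum>u\<in>Poly_Mapping.keys x. \<Sum>v\<in>Poly_Mapping.keys y.
     pm_scale (Poly_Mapping.lookup x u * Poly_Mapping.lookup y v) (basis_mult \<delta> u v))"

text \<open>The index set of the sum in \<open>basis_mult\<close> is finite, so that sum is not the default
  value \<open>0\<close> of a sum over an infinite set.\<close>

lemma finite_basis_mult_index:
  "finite {v'. reduction \<delta> v' = v \<and> u @ v' \<in> cliffs \<delta>}"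
proof (rule finite_subset)
  let ?B = "\<Union>i\<in>{1..length u + length v}. {..\<delta> i}"
  show "{v'. reduction \<delta> v' = v \<and> u @ v' \<in> cliffs \<delta>}
      \<subseteq> {w. set w \<subseteq> ?B \<and> length w = length v}"
  proof (safe)
    fix w x assume w: "u @ w \<in> cliffs \<delta>" "x \<in> set w" "v = reduction \<delta> w"
    then obtain j where j: "j < length w" "x = w ! j" by (auto simp: in_set_conv_nth)
    have "(u @ w) ! (Suc (length u + j) - 1) \<le> \<delta> (Suc (length u + j))"
      using w(1) j(1) unfolding cliffs_def
      by (intro bspec[where P = "\<lambda>i. (u @ w) ! (i - 1) \<le> \<delta> i"]) auto
    then show "x \<in> (\<Union>i\<in>{1..length u + length (reduction \<delta> w)}. {..\<delta> i})"
      using j by (auto simp: reduction_def nth_append intro!: bexI[of _ "Suc (length u + j)"])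
  qed (simp add: reduction_def del: upt_Suc)
  show "finite {w. set w \<subseteq> ?B \<and> length w = length v}"
    by (rule finite_lists_length_eq) auto
qed

lemma cliff_mult_F: "cliff_mult \<delta> (F u) (F v) = basis_mult \<delta> u v"
proof -
  have "pm_scale 1 p = p" for p :: "nat list \<Rightarrow>\<^sub>0 'k::field"
    by (rule poly_mapping_eqI) (simp add: Poly_Mapping.map.rep_eq when_def)
  then show ?thesis by (simp add: cliff_mult_def F_def)
qed

end

theory Submission
  imports Defs
begin

text \<open>
  Reading the product dually makes everything computable. A word \<open>t\<close> occurs in the product of the
  basis elements of \<open>u\<close> and \<open>v\<close> exactly when \<open>t\<close> is a cliff that starts with \<open>u\<close> and whose
  remaining suffix reduces to \<open>v\<close>, and it then occurs once. Hence (\<open>lookup_cliff_mult\<close>) the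
  coefficient of a cliff \<open>t\<close> in \<open>x \<cdot> y\<close> is the sum, over all ways of cutting \<open>t\<close> into a prefix \<open>p\<close>
  and a suffix \<open>s\<close>, of the coefficient of \<open>p\<close> in \<open>x\<close> times the coefficient of the reduction of \<open>s\<close>
  in \<open>y\<close>. Bilinearity, the grading by length and the unit (the empty word) are immediate from
  this formula.

  Iterating it, both \<open>(x \<cdot> y) \<cdot> z\<close> and \<open>x \<cdot> (y \<cdot> z)\<close> become sums over the ways of cutting a cliff into
  three factors \<open>p\<close>, \<open>q\<close>, \<open>s\<close>. The factor \<open>p\<close> is read off unchanged and \<open>q\<close> is reduced once in both
  cases. The only difference lies in \<open>s\<close>: the left bracketing reduces it once, with \<open>s\<close> moved to
  the start of the word, whereas the right bracketing reduces it first at position \<open>|q|\<close> and then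
  again at the start. For a letter \<open>a\<close> of \<open>s\<close> at position \<open>i\<close>, the first gives
  \<open>min a (\<delta> i)\<close> and the second \<open>min (min a (\<delta> (|q| + i))) (\<delta> i)\<close>. Since \<open>a \<le> \<delta> (|p| + |q| + i)\<close>,
  these can differ only if \<open>p\<close> and \<open>q\<close> are nonempty and the values of \<open>\<delta>\<close> at
  \<open>i < |q| + i < |p| + |q| + i\<close> form a valley
  (\<open>reduction_drop_reduction_drop\<close>). Conversely, a valley provides a triple of words, with a
  single nonzero letter, on which the two bracketings differ (\<open>associative_imp_valley_free\<close>).
\<close>

section \<open>Cliffs and reduction\<close>

lemma cliffs_iff_nth: "u \<in> cliffs \<delta> \<longleftrightarrow> (\<forall>i<length u. u ! i \<le> \<delta> (Suc i))"
proof -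
  have "(\<forall>i\<in>{1..length u}. u ! (i - 1) \<le> \<delta> i) \<longleftrightarrow> (\<forall>i\<in>Suc ` {..<length u}. u ! (i - 1) \<le> \<delta> i)"
    by (simp add: image_Suc_lessThan)
  then show ?thesis by (auto simp: cliffs_def)
qed

lemma Nil_in_cliffs: "[] \<in> cliffs \<delta>"
  by (simp add: cliffs_iff_nth)

lemma replicate_0_append_in_cliffs_iff: "replicate m 0 @ [a] \<in> cliffs \<delta> \<longleftrightarrow> a \<le> \<delta> (Suc m)"
  by (auto simp: cliffs_iff_nth nth_append less_Suc_eq)

lemma take_in_cliffs: "u \<in> cliffs \<delta> \<Longrightarrow> take k u \<in> cliffs \<delta>"
  by (simp add: cliffs_iff_nth)

lemma length_reduction [simp]: "length (reduction \<delta> u) = length u"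
  by (simp add: reduction_def del: upt_Suc)

lemma nth_reduction [simp]:
  "i < length u \<Longrightarrow> reduction \<delta> u ! i = min (u ! i) (\<delta> (Suc i))"
  by (simp add: reduction_def del: upt_Suc)

lemma reduction_in_cliffs: "reduction \<delta> u \<in> cliffs \<delta>"
  by (simp add: cliffs_iff_nth)

lemma reduction_cliff: "u \<in> cliffs \<delta> \<Longrightarrow> reduction \<delta> u = u"
  by (rule nth_equalityI) (simp_all add: cliffs_iff_nth min_absorb1)

lemma take_reduction: "take k (reduction \<delta> u) = reduction \<delta> (take k u)"
  by (rule nth_equalityI) simp_all

text \<open>Associativity comes down to this: reducing a suffix of a cliff at an intermediate position
  before reducing it at the start changes nothing. The first reduction matters only for a letter
  above the bound at its intermediate position, when this bound is also below the one at its final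
  position. As a letter of a cliff obeys the bound at its original position, the three bounds then
  form a valley.\<close>

lemma reduction_drop_reduction_drop:
  assumes "valley_free \<delta>" and t: "t \<in> cliffs \<delta>"
  shows "reduction \<delta> (drop l (reduction \<delta> (drop j t))) = reduction \<delta> (drop (j + l) t)"
proof (rule nth_equalityI)
  fix i assume "i < length (reduction \<delta> (drop l (reduction \<delta> (drop j t))))"
  then have i: "j + l + i < length t" by simp
  define a where "a = t ! (j + l + i)"
  have a: "a \<le> \<delta> (Suc (j + l + i))"
    using t i by (simp add: cliffs_iff_nth a_def)
  have "min (min a (\<delta> (Suc (l + i)))) (\<delta> (Suc i)) = min a (\<delta> (Suc i))"
  proof (cases "j = 0 \<or> l = 0")
    case True
    then show ?thesis using a by auto
  next
    case False
    then have "1 \<le> Suc i" "Suc i < Suc (l + i)" "Suc (l + i) < Suc (j + l + i)" by auto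
    then have "\<not> (\<delta> (Suc i) > \<delta> (Suc (l + i)) \<and> \<delta> (Suc (l + i)) < \<delta> (Suc (j + l + i)))"
      using assms(1) unfolding valley_free_def by blast
    then show ?thesis using a by linarith
  qed
  then show "reduction \<delta> (drop l (reduction \<delta> (drop j t))) ! i
      = reduction \<delta> (drop (j + l) t) ! i"
    using i by (simp add: a_def add.assoc)
qed simp

section \<open>Coefficients of a product\<close>

lemma lookup_pm_scale [simp]:
  "Poly_Mapping.lookup (pm_scale c x) t = (c :: 'k::field) * Poly_Mapping.lookup x t"
  by (simp add: Poly_Mapping.map.rep_eq when_def)

lemma lookup_F: "Poly_Mapping.lookup (F u :: _ \<Rightarrow>\<^sub>0 'k::field) t = (if u = t then 1 else 0)"
  by (simp add: F_def lookup_single when_def)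

lemma F_in_cliff_space: "u \<in> cliffs \<delta> \<Longrightarrow> (F u :: _ \<Rightarrow>\<^sub>0 'k::field) \<in> cliff_space \<delta>"
  by (simp add: cliff_space_def F_def)

lemma lookup_basis_mult:
  "Poly_Mapping.lookup (basis_mult \<delta> u v :: _ \<Rightarrow>\<^sub>0 'k::field) t =
    (if t \<in> cliffs \<delta> \<and> take (length u) t = u \<and> reduction \<delta> (drop (length u) t) = v
     then 1 else 0)"
proof -
  let ?S = "{v'. reduction \<delta> v' = v \<and> u @ v' \<in> cliffs \<delta>}"
  have fin: "finite ?S" by (rule finite_basis_mult_index)
  have split: "u @ v' = t \<longleftrightarrow> take (length u) t = u \<and> v' = drop (length u) t" for v'
    by (auto simp: append_eq_conv_conj)
  have "Poly_Mapping.lookup (basis_mult \<delta> u v :: _ \<Rightarrow>\<^sub>0 'k) t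
      = (\<Sum>v'\<in>?S. if take (length u) t = u \<and> v' = drop (length u) t then 1 else 0)"
    by (simp add: basis_mult_def lookup_sum lookup_F split)
  also have "\<dots> = (if take (length u) t = u \<and> drop (length u) t \<in> ?S then 1 else 0)"
    using fin by (cases "take (length u) t = u") simp_all
  also have "\<dots> = (if t \<in> cliffs \<delta> \<and> take (length u) t = u
      \<and> reduction \<delta> (drop (length u) t) = v then 1 else 0)"
  proof (cases "take (length u) t = u")
    case True
    then have "u @ drop (length u) t = t" by (metis append_take_drop_id)
    with True show ?thesis by auto
  qed simp
  finally show ?thesis .
qed

text \<open>The product is dual to deconcatenation followed by reduction of the suffix: a basis element
  of \<open>x\<close> contributes to \<open>t\<close> only if its word is a prefix of \<open>t\<close>, and then the reduction of the
  remaining suffix is the only word of \<open>y\<close> that can complete it.\<close>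

lemma lookup_cliff_mult:
  fixes x y :: "nat list \<Rightarrow>\<^sub>0 'k::field"
  shows "Poly_Mapping.lookup (cliff_mult \<delta> x y) t =
    (if t \<in> cliffs \<delta>
     then \<Sum>k\<le>length t. Poly_Mapping.lookup x (take k t)
            * Poly_Mapping.lookup y (reduction \<delta> (drop k t))
     else 0)"
proof (cases "t \<in> cliffs \<delta>")
  case True
  define g where "g u = Poly_Mapping.lookup x u
    * Poly_Mapping.lookup y (reduction \<delta> (drop (length u) t))" for u
  have inner: "(\<Sum>v\<in>Poly_Mapping.keys y. Poly_Mapping.lookup x u * Poly_Mapping.lookup y v
        * Poly_Mapping.lookup (basis_mult \<delta> u v) t)
      = (if take (length u) t = u then g u else 0)" for u
  proof (cases "take (length u) t = u")
    case prefix: True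
    let ?w = "reduction \<delta> (drop (length u) t)"
    have "(\<Sum>v\<in>Poly_Mapping.keys y. Poly_Mapping.lookup x u * Poly_Mapping.lookup y v
        * Poly_Mapping.lookup (basis_mult \<delta> u v) t)
      = (\<Sum>v\<in>Poly_Mapping.keys y. if ?w = v
          then Poly_Mapping.lookup x u * Poly_Mapping.lookup y v else 0)"
      using True prefix by (intro sum.cong) (simp_all add: lookup_basis_mult)
    also have "\<dots> = g u"
      by (simp add: g_def in_keys_iff)
    finally show ?thesis using prefix by simp
  next
    case False
    then show ?thesis by (simp add: lookup_basis_mult)
  qed
  have inj: "inj_on (\<lambda>k. take k t) {..length t}"
    by (rule inj_on_inverseI[where g = length]) simp
  have "Poly_Mapping.lookup (cliff_mult \<delta> x y) t
      = (\<Sum>u\<in>Poly_Mapping.keys x. if take (length u) t = u then g u else 0)"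
    by (simp add: cliff_mult_def lookup_sum inner)
  also have "\<dots> = sum g ((\<lambda>k. take k t) ` {..length t})"
  proof (rule sum.mono_neutral_cong)
    fix u assume "u \<in> Poly_Mapping.keys x - (\<lambda>k. take k t) ` {..length t}"
    then show "(if take (length u) t = u then g u else 0) = 0"
      by (metis DiffD2 atMost_iff image_eqI length_take min.cobounded1)
  qed (auto simp: g_def in_keys_iff min_absorb2)
  also have "\<dots> = (\<Sum>k\<le>length t. g (take k t))"
    using inj by (simp add: sum.reindex)
  also have "\<dots> = (\<Sum>k\<le>length t. Poly_Mapping.lookup x (take k t)
            * Poly_Mapping.lookup y (reduction \<delta> (drop k t)))"
    by (intro sum.cong) (simp_all add: g_def min_absorb2)
  finally show ?thesis using True by simp
next
  case False
  then show ?thesis by (simp add: cliff_mult_def lookup_sum lookup_basis_mult)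
qed

text \<open>When one factor is a basis element, its length singles out one cut of \<open>t\<close>.\<close>

lemma lookup_F_cliff_mult:
  fixes y :: "nat list \<Rightarrow>\<^sub>0 'k::field"
  shows "Poly_Mapping.lookup (cliff_mult \<delta> (F u) y) t =
    (if t \<in> cliffs \<delta> \<and> take (length u) t = u
     then Poly_Mapping.lookup y (reduction \<delta> (drop (length u) t)) else 0)"
proof -
  have "(\<Sum>k\<le>length t. Poly_Mapping.lookup (F u :: _ \<Rightarrow>\<^sub>0 'k) (take k t)
          * Poly_Mapping.lookup y (reduction \<delta> (drop k t)))
      = (\<Sum>k\<le>length t. if k = length u then (if take (length u) t = u
          then Poly_Mapping.lookup y (reduction \<delta> (drop (length u) t)) else 0) else 0)"
    by (intro sum.cong) (auto simp: lookup_F min_absorb2)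
  also have "\<dots> = (if take (length u) t = u
          then Poly_Mapping.lookup y (reduction \<delta> (drop (length u) t)) else 0)"
    by (auto dest: arg_cong[where f = length])
  finally show ?thesis by (simp add: lookup_cliff_mult)
qed

lemma lookup_cliff_mult_F:
  fixes x :: "nat list \<Rightarrow>\<^sub>0 'k::field"
  assumes w: "w \<in> cliffs \<delta>" and "u @ w \<in> cliffs \<delta>"
  shows "Poly_Mapping.lookup (cliff_mult \<delta> x (F w)) (u @ w) = Poly_Mapping.lookup x u"
proof -
  have "Poly_Mapping.lookup (cliff_mult \<delta> x (F w)) (u @ w)
      = (\<Sum>k\<le>length (u @ w). if k = length u then Poly_Mapping.lookup x u else 0)"
    unfolding lookup_cliff_mult if_P[OF assms(2)]
  proof (rule sum.cong)
    fix k assume k: "k \<in> {..length (u @ w)}"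
    have "w \<noteq> reduction \<delta> (drop k (u @ w))" if "k \<noteq> length u"
    proof
      assume "w = reduction \<delta> (drop k (u @ w))"
      then have "length w = length (u @ w) - k" by (metis length_drop length_reduction)
      then show False using k that by simp
    qed
    then show "Poly_Mapping.lookup x (take k (u @ w))
          * Poly_Mapping.lookup (F w) (reduction \<delta> (drop k (u @ w)))
        = (if k = length u then Poly_Mapping.lookup x u else 0)"
      by (simp add: lookup_F reduction_cliff[OF w])
  qed simp
  then show ?thesis by simp
qed

section \<open>The graded algebra of cliffs\<close>

interpretation pm: vector_space "pm_scale :: 'k::field \<Rightarrow> ('w \<Rightarrow>\<^sub>0 'k) \<Rightarrow> ('w \<Rightarrow>\<^sub>0 'k)"
  by unfold_locales
    (rule poly_mapping_eqI, simp add: lookup_add algebra_simps)+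

lemma subspace_supported_on:
  "pm.subspace {x :: 'w \<Rightarrow>\<^sub>0 'k::field. Poly_Mapping.keys x \<subseteq> S}"
proof (rule pm.subspaceI)
  fix x y :: "'w \<Rightarrow>\<^sub>0 'k"
  assume "x \<in> {x. Poly_Mapping.keys x \<subseteq> S}" "y \<in> {x. Poly_Mapping.keys x \<subseteq> S}"
  then show "x + y \<in> {x. Poly_Mapping.keys x \<subseteq> S}"
    using Poly_Mapping.keys_add[of x y] by auto
qed (auto simp: in_keys_iff subset_iff)

text \<open>Grading the basis by any function \<open>d\<close> grades the finitely supported functions, the part of
  degree \<open>n\<close> being the restriction to the basis elements of degree \<open>n\<close>.\<close>

lemma graded_decomposition:
  fixes x :: "'w \<Rightarrow>\<^sub>0 'k::field" and d :: "'w \<Rightarrow> nat"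
  assumes x: "Poly_Mapping.keys x \<subseteq> S"
  shows "\<exists>!f. (\<forall>n. f n \<in> {y. Poly_Mapping.keys y \<subseteq> {u \<in> S. d u = n}})
    \<and> finite {n. f n \<noteq> 0} \<and> x = (\<Sum>n | f n \<noteq> 0. f n)"
proof (rule ex1I)
  define f where "f n = (\<Sum>u | u \<in> Poly_Mapping.keys x \<and> d u = n.
    Poly_Mapping.single u (Poly_Mapping.lookup x u))" for n
  have lookup_f: "Poly_Mapping.lookup (f n) u = (if d u = n then Poly_Mapping.lookup x u else 0)"
    for n u
    by (auto simp: f_def lookup_sum lookup_single when_def in_keys_iff)
  have f_keys: "Poly_Mapping.keys (f n) \<subseteq> {u \<in> S. d u = n}" for n
    using x by (auto simp: in_keys_iff subset_iff lookup_f split: if_splits)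
  have "{n. f n \<noteq> 0} \<subseteq> d ` Poly_Mapping.keys x"
  proof
    fix n assume "n \<in> {n. f n \<noteq> 0}"
    then obtain u where "Poly_Mapping.lookup (f n) u \<noteq> 0"
      by (metis mem_Collect_eq lookup_zero poly_mapping_eqI)
    then show "n \<in> d ` Poly_Mapping.keys x"
      by (auto simp: lookup_f in_keys_iff split: if_splits)
  qed
  then have fin: "finite {n. f n \<noteq> 0}" by (rule finite_subset) simp
  have "x = (\<Sum>n | f n \<noteq> 0. f n)"
  proof (rule poly_mapping_eqI)
    fix u
    have "f (d u) = 0 \<Longrightarrow> Poly_Mapping.lookup x u = 0"
      using lookup_f[of "d u" u] by simp
    then show "Poly_Mapping.lookup x u = Poly_Mapping.lookup (\<Sum>n | f n \<noteq> 0. f n) u"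
      using fin by (auto simp: lookup_sum lookup_f)
  qed
  then show "(\<forall>n. f n \<in> {y. Poly_Mapping.keys y \<subseteq> {u \<in> S. d u = n}})
    \<and> finite {n. f n \<noteq> 0} \<and> x = (\<Sum>n | f n \<noteq> 0. f n)"
    using f_keys fin by simp
  fix g assume g: "(\<forall>n. g n \<in> {y. Poly_Mapping.keys y \<subseteq> {u \<in> S. d u = n}})
    \<and> finite {n. g n \<noteq> 0} \<and> x = (\<Sum>n | g n \<noteq> 0. g n)"
  have off: "d u \<noteq> n \<Longrightarrow> Poly_Mapping.lookup (g n) u = 0" for u n
    using g by (fastforce simp: in_keys_iff subset_iff)
  have diag: "Poly_Mapping.lookup x u = Poly_Mapping.lookup (g (d u)) u" for u
  proof -
    have "Poly_Mapping.lookup x u = (\<Sum>n | g n \<noteq> 0. Poly_Mapping.lookup (g n) u)"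
      using g by (metis lookup_sum)
    also have "\<dots> = (\<Sum>n | g n \<noteq> 0. if n = d u then Poly_Mapping.lookup (g (d u)) u else 0)"
      by (intro sum.cong) (auto simp: off)
    also have "\<dots> = Poly_Mapping.lookup (g (d u)) u"
      using g by auto
    finally show ?thesis .
  qed
  show "g = f"
  proof (rule ext, rule poly_mapping_eqI)
    fix n u
    show "Poly_Mapping.lookup (g n) u = Poly_Mapping.lookup (f n) u"
      by (cases "d u = n") (auto simp: lookup_f diag off)
  qed
qed

lemma keys_cliff_mult_subset: "Poly_Mapping.keys (cliff_mult \<delta> x y) \<subseteq> cliffs \<delta>"
  by (auto simp: in_keys_iff lookup_cliff_mult split: if_splits)

lemma cliff_mult_graded:
  fixes x y :: "nat list \<Rightarrow>\<^sub>0 'k::field"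
  assumes x: "x \<in> cliff_space_component \<delta> m" and y: "y \<in> cliff_space_component \<delta> n"
  shows "cliff_mult \<delta> x y \<in> cliff_space_component \<delta> (m + n)"
proof -
  have "length t = m + n" if t: "t \<in> Poly_Mapping.keys (cliff_mult \<delta> x y)" for t
  proof -
    obtain k where k: "k \<le> length t" "Poly_Mapping.lookup x (take k t) \<noteq> 0"
      "Poly_Mapping.lookup y (reduction \<delta> (drop k t)) \<noteq> 0"
      using t by (auto simp: in_keys_iff lookup_cliff_mult split: if_splits
        elim!: sum.not_neutral_contains_not_neutral)
    then have "length (take k t) = m" "length (reduction \<delta> (drop k t)) = n"
      using x y unfolding cliff_space_component_def cliffs_of_size_def
      by (blast intro: in_keys_iff[THEN iffD2])+
    then show ?thesis using k(1) by simp
  qed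
  then show ?thesis
    using keys_cliff_mult_subset[of \<delta> x y]
    by (auto simp: cliff_space_component_def cliffs_of_size_def)
qed

lemma lookup_eq_0_if_not_cliff:
  "x \<in> cliff_space \<delta> \<Longrightarrow> t \<notin> cliffs \<delta> \<Longrightarrow> Poly_Mapping.lookup x t = 0"
  by (auto simp: cliff_space_def in_keys_iff)

lemma cliff_mult_unit_left:
  fixes x :: "nat list \<Rightarrow>\<^sub>0 'k::field"
  assumes "x \<in> cliff_space \<delta>"
  shows "cliff_mult \<delta> (F []) x = x"
  using assms
  by (intro poly_mapping_eqI)
    (auto simp: lookup_F_cliff_mult reduction_cliff lookup_eq_0_if_not_cliff)

lemma cliff_mult_unit_right:
  fixes x :: "nat list \<Rightarrow>\<^sub>0 'k::field"
  assumes "x \<in> cliff_space \<delta>"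
  shows "cliff_mult \<delta> x (F []) = x"
proof (rule poly_mapping_eqI)
  fix t
  show "Poly_Mapping.lookup (cliff_mult \<delta> x (F [])) t = Poly_Mapping.lookup x t"
    using lookup_cliff_mult_F[OF Nil_in_cliffs, of t \<delta> x] assms
    by (cases "t \<in> cliffs \<delta>") (simp_all add: lookup_eq_0_if_not_cliff lookup_cliff_mult)
qed

lemma unital_graded_magmatic_algebra_cliff:
  "unital_graded_magmatic_algebra
    (pm_scale :: 'k::field \<Rightarrow> (nat list \<Rightarrow>\<^sub>0 'k) \<Rightarrow> (nat list \<Rightarrow>\<^sub>0 'k))
    (cliff_space \<delta>) (cliff_mult \<delta>) (cliff_space_component \<delta>)"
proof unfold_locales
  fix x y z :: "nat list \<Rightarrow>\<^sub>0 'k" and c :: 'k and m n :: nat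
  show "pm.subspace (cliff_space \<delta> :: (nat list \<Rightarrow>\<^sub>0 'k) set)"
    unfolding cliff_space_def by (rule subspace_supported_on)
  show "pm.subspace (cliff_space_component \<delta> n :: (nat list \<Rightarrow>\<^sub>0 'k) set)"
    unfolding cliff_space_component_def by (rule subspace_supported_on)
  show "cliff_mult \<delta> x y \<in> cliff_space \<delta>"
    using keys_cliff_mult_subset by (auto simp: cliff_space_def)
  show "cliff_mult \<delta> (x + y) z = cliff_mult \<delta> x z + cliff_mult \<delta> y z"
    by (rule poly_mapping_eqI)
      (simp add: lookup_cliff_mult lookup_add distrib_right sum.distrib)
  show "cliff_mult \<delta> x (y + z) = cliff_mult \<delta> x y + cliff_mult \<delta> x z"
    by (rule poly_mapping_eqI)
      (simp add: lookup_cliff_mult lookup_add distrib_left sum.distrib)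
  show "cliff_mult \<delta> (pm_scale c x) y = pm_scale c (cliff_mult \<delta> x y)"
    by (rule poly_mapping_eqI) (simp add: lookup_cliff_mult sum_distrib_left mult.assoc)
  show "cliff_mult \<delta> x (pm_scale c y) = pm_scale c (cliff_mult \<delta> x y)"
    by (rule poly_mapping_eqI)
      (simp add: lookup_cliff_mult sum_distrib_left mult.left_commute)
  show "(cliff_space_component \<delta> n :: (nat list \<Rightarrow>\<^sub>0 'k) set) \<subseteq> cliff_space \<delta>"
    by (auto simp: cliff_space_component_def cliff_space_def cliffs_of_size_def)
  show "\<exists>!f. (\<forall>n. f n \<in> cliff_space_component \<delta> n) \<and> finite {n. f n \<noteq> 0}
      \<and> x = (\<Sum>n | f n \<noteq> 0. f n)" if "x \<in> cliff_space \<delta>"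
    using graded_decomposition[of x "cliffs \<delta>" length] that
    by (simp add: cliff_space_def cliff_space_component_def cliffs_of_size_def)
  show "cliff_mult \<delta> x y \<in> cliff_space_component \<delta> (m + n)"
    if "x \<in> cliff_space_component \<delta> m" "y \<in> cliff_space_component \<delta> n"
    using that by (rule cliff_mult_graded)
  have "(F [] :: nat list \<Rightarrow>\<^sub>0 'k) \<in> cliff_space_component \<delta> 0"
    by (simp add: cliff_space_component_def cliffs_of_size_def F_def Nil_in_cliffs)
  then show "\<exists>e\<in>cliff_space_component \<delta> 0. \<forall>x\<in>cliff_space \<delta>.
      cliff_mult \<delta> e x = (x :: nat list \<Rightarrow>\<^sub>0 'k) \<and> cliff_mult \<delta> x e = x"
    by (rule bexI[rotated]) (simp add: cliff_mult_unit_left cliff_mult_unit_right)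
qed

section \<open>Associativity and valleys\<close>

text \<open>Both bracketings are sums over pairs of cuts of \<open>t\<close>; they are indexed by \<open>j \<le> k\<close>, the two
  cutting positions, on the left, and by \<open>j\<close> and the length \<open>k - j\<close> of the middle factor on the
  right.\<close>

lemma valley_free_imp_cliff_mult_assoc:
  fixes x y z :: "nat list \<Rightarrow>\<^sub>0 'k::field"
  assumes vf: "valley_free \<delta>"
  shows "cliff_mult \<delta> (cliff_mult \<delta> x y) z = cliff_mult \<delta> x (cliff_mult \<delta> y z)"
proof (rule poly_mapping_eqI)
  fix t
  show "Poly_Mapping.lookup (cliff_mult \<delta> (cliff_mult \<delta> x y) z) t
      = Poly_Mapping.lookup (cliff_mult \<delta> x (cliff_mult \<delta> y z)) t"
  proof (cases "t \<in> cliffs \<delta>")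
    case True
    define n where "n = length t"
    define h where "h j l = Poly_Mapping.lookup x (take j t)
      * (Poly_Mapping.lookup y (reduction \<delta> (take l (drop j t)))
      * Poly_Mapping.lookup z (reduction \<delta> (drop (j + l) t)))" for j l
    have "Poly_Mapping.lookup (cliff_mult \<delta> (cliff_mult \<delta> x y) z) t
        = (\<Sum>k\<le>n. \<Sum>j\<le>k. h j (k - j))"
      using True unfolding lookup_cliff_mult[of \<delta> "cliff_mult \<delta> x y"]
      by (auto intro!: sum.cong simp: n_def h_def lookup_cliff_mult take_in_cliffs min_absorb2
          sum_distrib_right drop_take min_absorb1 mult.assoc)
    also have "\<dots> = (\<Sum>j\<le>n. \<Sum>l\<le>n - j. h j l)"
    proof -
      have "(\<Sum>k\<le>n. \<Sum>j\<le>k. h j (k - j)) = (\<Sum>(j, l) | j + l \<le> n. h j l)"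
        by (rule sum.triangle_reindex_eq[symmetric])
      also have "{(j, l). j + l \<le> n} = Sigma {..n} (\<lambda>j. {..n - j})" by auto
      finally show ?thesis by (simp add: sum.Sigma)
    qed
    also have "\<dots> = Poly_Mapping.lookup (cliff_mult \<delta> x (cliff_mult \<delta> y z)) t"
      using True unfolding lookup_cliff_mult[of \<delta> x]
      by (auto intro!: sum.cong simp: n_def h_def lookup_cliff_mult reduction_in_cliffs
          take_reduction reduction_drop_reduction_drop[OF vf True] sum_distrib_left)
    finally show ?thesis .
  next
    case False
    then show ?thesis by (simp add: lookup_cliff_mult)
  qed
qed

text \<open>Given a valley at \<open>i\<^sub>1 < i\<^sub>2 < i\<^sub>3\<close>, put the letter \<open>\<delta> i\<^sub>2 + 1\<close> at the end of a word \<open>w\<close> of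
  length \<open>i\<^sub>1\<close> with all other letters zero, and let \<open>v\<close> and \<open>u\<close> be zero words of lengths
  \<open>i\<^sub>2 - i\<^sub>1\<close> and \<open>i\<^sub>3 - i\<^sub>2\<close>, so that this letter is admissible at its places in \<open>w\<close> and in \<open>u v w\<close> but not in \<open>v w\<close>. Then \<open>u v w\<close> occurs in the
  product bracketed to the left; it does not in the one bracketed to the right, since passing
  through \<open>v w\<close> truncates the letter to \<open>\<delta> i\<^sub>2\<close>.\<close>

lemma associative_imp_valley_free:
  assumes assoc: "associative_on (cliff_space \<delta> :: (nat list \<Rightarrow>\<^sub>0 'k::field) set) (cliff_mult \<delta>)"
  shows "valley_free \<delta>"
  unfolding valley_free_def
proof (rule notI, elim exE conjE)
  fix i1 i2 i3
  assume i: "1 \<le> i1" "i1 < i2" "i2 < i3" and valley: "\<delta> i2 < \<delta> i1" "\<delta> i2 < \<delta> i3"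
  define u where "u = replicate (i3 - i2) (0::nat)"
  define v where "v = replicate (i2 - i1) (0::nat)"
  define w where "w = replicate (i1 - 1) 0 @ [Suc (\<delta> i2)]"
  define t where "t = u @ v @ w"
  have w_cliff: "w \<in> cliffs \<delta>"
    using i valley by (simp add: w_def replicate_0_append_in_cliffs_iff)
  have uv_cliff: "u @ v \<in> cliffs \<delta>" and u_cliff: "u \<in> cliffs \<delta>" and v_cliff: "v \<in> cliffs \<delta>"
    by (auto simp: cliffs_iff_nth u_def v_def nth_append)
  have t_eq: "t = replicate (i3 - 1) 0 @ [Suc (\<delta> i2)]"
    using i by (simp add: t_def u_def v_def w_def flip: append_assoc replicate_add)
  have t_cliff: "t \<in> cliffs \<delta>"
    using i valley by (simp add: t_eq replicate_0_append_in_cliffs_iff)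
  have "Poly_Mapping.lookup
      (cliff_mult \<delta> (cliff_mult \<delta> (F u) (F v)) (F w) :: _ \<Rightarrow>\<^sub>0 'k) t = 1"
    using lookup_cliff_mult_F[OF w_cliff, of "u @ v" "cliff_mult \<delta> (F u) (F v) :: _ \<Rightarrow>\<^sub>0 'k"] t_cliff
    by (simp add: t_def lookup_F_cliff_mult lookup_F uv_cliff reduction_cliff[OF v_cliff])
  moreover have "Poly_Mapping.lookup
      (cliff_mult \<delta> (F u) (cliff_mult \<delta> (F v) (F w)) :: _ \<Rightarrow>\<^sub>0 'k) t = 0"
  proof -
    have vw: "v @ w = replicate (i2 - 1) 0 @ [Suc (\<delta> i2)]"
      using i by (simp add: v_def w_def flip: append_assoc replicate_add)
    have len: "length v = i2 - i1" "length w = i1"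
      using i by (simp_all add: v_def w_def)
    have "reduction \<delta> (v @ w) ! (i2 - 1) = \<delta> i2"
      using i by (simp add: vw nth_append)
    moreover have "length v + (i1 - 1) = i2 - 1"
      using i by (simp add: len)
    ultimately have "reduction \<delta> (drop (length v) (reduction \<delta> (v @ w))) ! (i1 - 1) = \<delta> i2"
      using i valley by (simp add: len del: nth_reduction) (simp add: len)
    moreover have "w ! (i1 - 1) = Suc (\<delta> i2)"
      by (simp add: w_def nth_append)
    ultimately have "reduction \<delta> (drop (length v) (reduction \<delta> (v @ w))) \<noteq> w"
      by auto
    then show ?thesis
      by (auto simp: lookup_F_cliff_mult t_def lookup_F)
  qed
  ultimately have "cliff_mult \<delta> (cliff_mult \<delta> (F u) (F v)) (F w)
      \<noteq> (cliff_mult \<delta> (F u) (cliff_mult \<delta> (F v) (F w)) :: _ \<Rightarrow>\<^sub>0 'k)"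
    by auto
  then show False
    using assoc u_cliff v_cliff w_cliff by (auto simp: associative_on_def F_in_cliff_space)
qed

theorem theorem3p1p1:
  fixes \<delta> :: "nat \<Rightarrow> nat"
  shows "unital_graded_magmatic_algebra
      (pm_scale :: 'k::field_char_0 \<Rightarrow> (nat list \<Rightarrow>\<^sub>0 'k) \<Rightarrow> (nat list \<Rightarrow>\<^sub>0 'k))
      (cliff_space \<delta>) (cliff_mult \<delta>) (cliff_space_component \<delta>)
    \<and> (associative_on (cliff_space \<delta> :: (nat list \<Rightarrow>\<^sub>0 'k) set) (cliff_mult \<delta>)
        \<longleftrightarrow> valley_free \<delta>)"
proof (intro conjI iffI)
  show "unital_graded_magmatic_algebra
      (pm_scale :: 'k \<Rightarrow> (nat list \<Rightarrow>\<^sub>0 'k) \<Rightarrow> (nat list \<Rightarrow>\<^sub>0 'k))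
      (cliff_space \<delta>) (cliff_mult \<delta>) (cliff_space_component \<delta>)"
    by (rule unital_graded_magmatic_algebra_cliff)
  show "associative_on (cliff_space \<delta> :: (nat list \<Rightarrow>\<^sub>0 'k) set) (cliff_mult \<delta>)"
    if "valley_free \<delta>"
    unfolding associative_on_def by (intro ballI valley_free_imp_cliff_mult_assoc that)
qed (rule associative_imp_valley_free)

end
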